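(* Let $a<b$, $I=[a,b]$, $n\ge 0$ an integer, and let $f,u_0,u_1,\dots,u_n\in C^{n+1}([a,b])$ be real-valued functions such that the Wronskians satisfy $W_i(x)>0$ for all $x\in[a,b]$ and $i=0,1,\dots,n$. Assume $L_if(a)=0$ for $i=0,1,\dots,n$, where $L_i$ are the Widder derivatives. Let $x\in I$, let $\alpha,\beta>0$, $r>\max(1,\alpha)$, and let $u,v\in C(I)$ be such that $u(s)\ge 0$ and $v(s)>0$ for all $s\in I$. Then $$\left|\int_a^x u(s)|f(s)|^{\beta}|L_{n+1}f(s)|^{\alpha}\,ds\right|\le C_1(x)\left|\int_a^x v(s)|L_{n+1}f(s)|^{r}\,ds\right|^{\frac{\alpha+\beta}{r}},$$ where $$C_1(x):=\left(\frac{\alpha}{\alpha+\beta}\right)^{\frac{\alpha}{r}}\left(\int_a^x\left(u(s)^{r}v(s)^{-\alpha}\right)^{\frac{1}{r-\alpha}}P_1(s)^{\frac{\beta(r-1)}{r-\alpha}}\,ds\right)^{\frac{r-\alpha}{r}}$$ and $$P_1(s):=\left|\int_a^s v(t)^{-\frac{1}{r-1}}\,g_n(s,t)^{\frac{r}{r-1}}\,dt\right|.$$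
   Context: For $i=0,1,\dots,n$, $W_i(x):=W[u_0(x),\dots,u_i(x)]$ is the Wronskian determinant of $u_0,\dots,u_i$ at $x$, i.e. the $(i+1)\times(i+1)$ determinant whose rows are $(u_0^{(k)}(x),\dots,u_i^{(k)}(x))$, $k=0,\dots,i$; in particular $W_0=u_0$. Widder derivatives: $L_0f(x):=f(x)$ and, for $i=1,\dots,n+1$, $$L_if(x):=\frac{W[u_0(x),u_1(x),\dots,u_{i-1}(x),f(x)]}{W_{i-1}(x)},\qquad x\in[a,b],$$ where the numerator is the Wronskian of $u_0,\dots,u_{i-1},f$ at $x$. Kernels: $g_0(x,t):=u_0(x)/u_0(t)$ and, for $i=1,\dots,n$, $g_i(x,t):=\frac{1}{W_i(t)}D_i(x,t)$ for $x,t\in[a,b]$, where $D_i(x,t)$ is the $(i+1)\times(i+1)$ determinant whose first $i$ rows are $(u_0^{(k)}(t),\dots,u_i^{(k)}(t))$, $k=0,\dots,i-1$, and whose last row is $(u_0(x),\dots,u_i(x))$. (For $a\le t\le s\le b$ one has $g_n(s,t)\ge0$, so the power of $g_n$ in the claim is a power of a nonnegative number.) The weights $u,v$ are unrelated to the functions $u_0,\dots,u_n$. *)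

theory Defs
  imports "HOL-Analysis.Analysis" "Jordan_Normal_Form.Determinant"
begin

text \<open>
  Derivatives are taken relative to the set \<open>S\<close>; for \<open>S = {a..b}\<close> with \<open>a < b\<close> they are
  one-sided at the end points, and values outside \<open>S\<close> play no role at points of \<open>S\<close>.
\<close>

definition nth_deriv_on :: "real set \<Rightarrow> nat \<Rightarrow> (real \<Rightarrow> real) \<Rightarrow> real \<Rightarrow> real" where
  "nth_deriv_on S k f = ((\<lambda>g x. vector_derivative g (at x within S)) ^^ k) f"

definition C_on :: "nat \<Rightarrow> real set \<Rightarrow> (real \<Rightarrow> real) \<Rightarrow> bool" where
  "C_on k S f \<longleftrightarrow>
     (\<forall>j<k. nth_deriv_on S j f differentiable_on S) \<and> continuous_on S (nth_deriv_on S k f)"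

text \<open>
  \<open>wronskian S m \<phi> x\<close> is the \<open>m \<times> m\<close> Wronskian determinant of \<open>\<phi> 0, \<dots>, \<phi> (m - 1)\<close>.
  Both \<open>HOL-Analysis\<close> and \<open>Jordan_Normal_Form\<close> have constants \<open>mat\<close> and \<open>det\<close>; the latter's,
  whose dimensions are terms, are the ones used here.
\<close>

definition wronskian :: "real set \<Rightarrow> nat \<Rightarrow> (nat \<Rightarrow> real \<Rightarrow> real) \<Rightarrow> real \<Rightarrow> real" where
  "wronskian S m \<phi> x =
     Determinant.det (Matrix.mat m m (\<lambda>(k, j). nth_deriv_on S k (\<phi> j) x))"

definition Wr :: "real set \<Rightarrow> (nat \<Rightarrow> real \<Rightarrow> real) \<Rightarrow> nat \<Rightarrow> real \<Rightarrow> real" where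
  "Wr S \<phi> i x = wronskian S (i + 1) \<phi> x"

definition widder :: "real set \<Rightarrow> (nat \<Rightarrow> real \<Rightarrow> real) \<Rightarrow> nat \<Rightarrow> (real \<Rightarrow> real) \<Rightarrow> real \<Rightarrow> real" where
  "widder S \<phi> i f x =
     (if i = 0 then f x
      else wronskian S (i + 1) (\<lambda>j. if j < i then \<phi> j else f) x / Wr S \<phi> (i - 1) x)"

definition g_kernel :: "real set \<Rightarrow> (nat \<Rightarrow> real \<Rightarrow> real) \<Rightarrow> nat \<Rightarrow> real \<Rightarrow> real \<Rightarrow> real" where
  "g_kernel S \<phi> i x t =
     (if i = 0 then \<phi> 0 x / \<phi> 0 t
      else 1 / Wr S \<phi> i t *
        Determinant.det (Matrix.mat (i + 1) (i + 1)
          (\<lambda>(k, j). if k < i then nth_deriv_on S k (\<phi> j) t else \<phi> j x)))"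

definition P1 ::
  "real \<Rightarrow> real \<Rightarrow> nat \<Rightarrow> (nat \<Rightarrow> real \<Rightarrow> real) \<Rightarrow> (real \<Rightarrow> real) \<Rightarrow> real \<Rightarrow> real \<Rightarrow> real" where
  "P1 a b n \<phi> v r s =
     \<bar>integral {a..s} (\<lambda>t. v t powr (- (1 / (r - 1))) * g_kernel {a..b} \<phi> n s t powr (r / (r - 1)))\<bar>"

definition C1 ::
  "real \<Rightarrow> real \<Rightarrow> nat \<Rightarrow> (nat \<Rightarrow> real \<Rightarrow> real) \<Rightarrow> (real \<Rightarrow> real) \<Rightarrow> (real \<Rightarrow> real)
   \<Rightarrow> real \<Rightarrow> real \<Rightarrow> real \<Rightarrow> real \<Rightarrow> real" where
  "C1 a b n \<phi> u v \<alpha> \<beta> r x =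
     (\<alpha> / (\<alpha> + \<beta>)) powr (\<alpha> / r) *
     (integral {a..x} (\<lambda>s. (u s powr r * v s powr (- \<alpha>)) powr (1 / (r - \<alpha>)) *
        P1 a b n \<phi> v r s powr (\<beta> * (r - 1) / (r - \<alpha>)))) powr ((r - \<alpha>) / r)"

end

theory Submission
  imports Defs
begin

text \<open>
  Write the derivatives \<open>f\<^sup>(\<^sup>k\<^sup>)\<close>, \<open>k \<le> i\<close>, as combinations \<open>\<Sum>j. u\<^sub>j\<^sup>(\<^sup>k\<^sup>) p\<^sub>j\<close> with \<open>j \<le> i\<close>.
  Differentiating these identities and applying Cramer's rule shows that \<open>p\<^sub>j'\<close> is
  \<open>L\<^sub>i\<^sub>+\<^sub>1 f\<close> times a cofactor of the Wronskian matrix divided by \<open>W\<^sub>i\<close>.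
  For \<open>i = n\<close>, integration gives the Taylor formula
  \<open>f(s) = \<integral> g\<^sub>n(s,t) L\<^sub>n\<^sub>+\<^sub>1 f(t) dt\<close> without any uniqueness theorem for differential equations.
  For \<open>j = i\<close> one gets \<open>(W\<^sub>i\<^sub>-\<^sub>1 L\<^sub>i f / W\<^sub>i)' = (W\<^sub>i\<^sub>-\<^sub>1 / W\<^sub>i) L\<^sub>i\<^sub>+\<^sub>1 f\<close>, so nonnegativity descends
  from \<open>L\<^sub>n\<close> to \<open>L\<^sub>0\<close>; applied to \<open>g\<^sub>n(\<cdot>, t)\<close> this yields \<open>g\<^sub>n \<ge> 0\<close>.
  With \<open>z(s) = \<integral> v |L\<^sub>n\<^sub>+\<^sub>1 f|\<^sup>r\<close> over \<open>[a, s]\<close>, Hoelder's inequality gives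
  \<open>|f| \<le> P\<^sub>1 powr ((r - 1) / r) * z powr (1 / r)\<close>, and a second application reduces the claim to
  the integral of \<open>z powr (\<beta> / \<alpha>) * z'\<close>.
\<close>

subsection \<open>Cofactors\<close>

text \<open>The cofactors of column \<open>i\<close> do not involve that column, so it may be
  replaced by \<open>F\<close> before expanding along it.\<close>

lemma cofactor_cramer:
  fixes A :: "nat \<Rightarrow> nat \<Rightarrow> real"
  assumes "i < m"
  shows "(\<Sum>k<m. cofactor (Matrix.mat m m (\<lambda>(k, j). A k j)) k i * F k) =
    Determinant.det (Matrix.mat m m (\<lambda>(k, j). if j = i then F k else A k j))"
    (is "?l = Determinant.det ?B")
proof -
  have B: "?B \<in> carrier_mat m m" by simp
  have "mat_delete ?B k i = mat_delete (Matrix.mat m m (\<lambda>(k, j). A k j)) k i" if "k < m" for k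
    using assms that by (intro eq_matI) (auto simp: mat_delete_def)
  then show ?thesis
    unfolding laplace_expansion_column[OF B assms] using assms
    by (intro sum.cong) (auto simp: cofactor_def)
qed

lemma cofactor_mult_left:
  fixes A :: "nat \<Rightarrow> nat \<Rightarrow> real"
  assumes "i < m"
  shows "(\<Sum>k<m. cofactor (Matrix.mat m m (\<lambda>(k, j). A k j)) k i * (\<Sum>j<m. A k j * p j)) =
    Determinant.det (Matrix.mat m m (\<lambda>(k, j). A k j)) * p i"
proof -
  let ?A = "Matrix.mat m m (\<lambda>(k, j). A k j)"
  have "Determinant.det (replace_col ?A (?A *\<^sub>v Matrix.vec m p) i) = p i * Determinant.det ?A"
    using cramer_lemma_mat[of ?A m "Matrix.vec m p" i] assms by simp
  moreover have "replace_col ?A (?A *\<^sub>v Matrix.vec m p) i =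
      Matrix.mat m m (\<lambda>(k, j). if j = i then \<Sum>j<m. A k j * p j else A k j)"
    by (intro eq_matI) (auto simp: replace_col_def scalar_prod_def lessThan_atLeast0)
  ultimately show ?thesis
    using assms by (simp add: cofactor_cramer)
qed

text \<open>An entry of the adjugate identity \<open>A * adj A = det A * 1\<close>; it both solves
  the Wronskian system and yields the initial values of the kernel.\<close>

lemma cofactor_mult_right:
  fixes A :: "nat \<Rightarrow> nat \<Rightarrow> real"
  assumes "i < m" "k < m"
  shows "(\<Sum>j<m. A k j * cofactor (Matrix.mat m m (\<lambda>(k, j). A k j)) i j) =
    (if k = i then Determinant.det (Matrix.mat m m (\<lambda>(k, j). A k j)) else 0)"
proof -
  let ?A = "Matrix.mat m m (\<lambda>(k, j). A k j)"
  have "(?A * adj_mat ?A) $$ (k, i) = (Determinant.det ?A \<cdot>\<^sub>m 1\<^sub>m m) $$ (k, i)"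
    by (simp add: adj_mat(2)[of ?A m])
  then show ?thesis
    using assms by (simp add: scalar_prod_def adj_mat_def lessThan_atLeast0 
      split: if_splits)
qed

lemma cofactor_corner:
  fixes A :: "nat \<Rightarrow> nat \<Rightarrow> real"
  shows "cofactor (Matrix.mat (Suc i) (Suc i) (\<lambda>(k, j). A k j)) i i =
    Determinant.det (Matrix.mat i i (\<lambda>(k, j). A k j))"
proof -
  have "mat_delete (Matrix.mat (Suc i) (Suc i) (\<lambda>(k, j). A k j)) i i = Matrix.mat i i (\<lambda>(k, j). A k j)"
    by (intro eq_matI) (auto simp: mat_delete_def)
  then show ?thesis by (simp add: cofactor_def)
qed

lemma det_last_column_zero:
  fixes A :: "nat \<Rightarrow> nat \<Rightarrow> real"
  assumes "\<And>k. k < i \<Longrightarrow> A k i = 0"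
  shows "Determinant.det (Matrix.mat (Suc i) (Suc i) (\<lambda>(k, j). A k j)) =
    A i i * Determinant.det (Matrix.mat i i (\<lambda>(k, j). A k j))"
  using assms laplace_expansion_column[of "Matrix.mat (Suc i) (Suc i) (\<lambda>(k, j). A k j)" "Suc i" i]
  by (simp add: cofactor_corner)

text \<open>Subtracting from the last column the combination of the first \<open>m\<close> columns
  with coefficients \<open>p\<close> leaves only its bottom entry.\<close>

lemma det_bordered:
  fixes A :: "nat \<Rightarrow> nat \<Rightarrow> real"
  assumes "\<And>k. k < m \<Longrightarrow> (\<Sum>j<m. A k j * p j) = F k"
  shows "Determinant.det (Matrix.mat (Suc m) (Suc m) (\<lambda>(k, j). if j < m then A k j else F k)) =
    Determinant.det (Matrix.mat m m (\<lambda>(k, j). A k j)) * (F m - (\<Sum>j<m. A m j * p j))"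
proof -
  let ?N = "\<lambda>k j. if j < m then A k j else F k"
  \<comment> \<open>The coefficients of this column operation; the last one is 1, so
    \<open>cofactor_mult_left\<close> at column \<open>m\<close> gives the determinant
    itself.\<close>
  let ?q = "\<lambda>j. if j < m then - p j else 1"
  let ?c = "\<lambda>k. cofactor (Matrix.mat (Suc m) (Suc m) (\<lambda>(k, j). ?N k j)) k m"
  have r: "(\<Sum>j<Suc m. ?N k j * ?q j) = F k - (\<Sum>j<m. A k j * p j)" for k
    by (simp add: sum_negf)
  have "Determinant.det (Matrix.mat (Suc m) (Suc m) (\<lambda>(k, j). ?N k j)) =
      (\<Sum>k<Suc m. ?c k * (\<Sum>j<Suc m. ?N k j * ?q j))"
    by (subst cofactor_mult_left) auto
  also have "\<dots> = ?c m * (F m - (\<Sum>j<m. A m j * p j))"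
    unfolding r using assms by simp
  also have "?c m = Determinant.det (Matrix.mat m m (\<lambda>(k, j). ?N k j))"
    by (rule cofactor_corner)
  also have "Matrix.mat m m (\<lambda>(k, j). ?N k j) = Matrix.mat m m (\<lambda>(k, j). A k j)"
    by (intro eq_matI) auto
  finally show ?thesis .
qed

section \<open>Regularity of determinants and cofactors of function matrices\<close>

lemma differentiable_prod_real:
  fixes f :: "'i \<Rightarrow> real \<Rightarrow> real"
  shows "(\<And>i. i \<in> I \<Longrightarrow> f i differentiable (at x within S)) \<Longrightarrow>
    (\<lambda>x. \<Prod>i\<in>I. f i x) differentiable (at x within S)"
  by (induction I rule: infinite_finite_induct) auto

lemma permutes_less:
  "p permutes {0..<m} \<Longrightarrow> i < m \<Longrightarrow> p i < m" for p :: "nat \<Rightarrow> nat"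
  using permutes_in_image[of p "{0..<m}" i] by simp

lemma differentiable_det:
  fixes A :: "nat \<Rightarrow> nat \<Rightarrow> real \<Rightarrow> real"
  assumes "\<And>k j. k < m \<Longrightarrow> j < m \<Longrightarrow> A k j differentiable (at x within S)"
  shows "(\<lambda>x. Determinant.det (Matrix.mat m m (\<lambda>(k, j). A k j x))) differentiable (at x within S)"
proof -
  have "(\<lambda>x. \<Sum>p | p permutes {0..<m}. signof p * (\<Prod>i=0..<m. A i (p i) x)) differentiable (at x within S)"
    using assms by (intro differentiable_sum ballI differentiable_mult differentiable_prod_real
      differentiable_const) (auto simp: finite_permutations permutes_less)
  then show ?thesis
    by (rule back_subst[of "\<lambda>f. f differentiable (at x within S)"])
       (auto simp: Determinant.det_def fun_eq_iff permutes_less intro!: sum.cong prod.cong)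
qed

lemma continuous_on_det:
  fixes A :: "nat \<Rightarrow> nat \<Rightarrow> real \<Rightarrow> real"
  assumes "\<And>k j. k < m \<Longrightarrow> j < m \<Longrightarrow> continuous_on S (A k j)"
  shows "continuous_on S (\<lambda>x. Determinant.det (Matrix.mat m m (\<lambda>(k, j). A k j x)))"
proof -
  have "continuous_on S (\<lambda>x. \<Sum>p | p permutes {0..<m}. signof p * (\<Prod>i=0..<m. A i (p i) x))"
    using assms by (intro continuous_on_sum continuous_on_mult continuous_on_prod)
      (auto simp: permutes_less)
  then show ?thesis
    by (rule back_subst[of "continuous_on S"])
       (auto simp: Determinant.det_def fun_eq_iff permutes_less intro!: sum.cong prod.cong)
qed

lemma differentiable_cofactor:
  fixes A :: "nat \<Rightarrow> nat \<Rightarrow> real \<Rightarrow> real"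
  assumes "\<And>k j. k < m \<Longrightarrow> j < m \<Longrightarrow> A k j differentiable (at x within S)"
  shows "(\<lambda>x. cofactor (Matrix.mat m m (\<lambda>(k, j). A k j x)) i l) differentiable (at x within S)"
proof -
  have *: "mat_delete (Matrix.mat m m (\<lambda>(k, j). A k j x)) i l = Matrix.mat (m - 1) (m - 1)
      (\<lambda>(k, j). A (if k < i then k else Suc k) (if j < l then j else Suc j) x)" for x
    by (intro eq_matI) (auto simp: mat_delete_def)
  show ?thesis
    unfolding cofactor_def * using assms
    by (intro differentiable_mult differentiable_det) auto
qed

lemma continuous_on_cofactor:
  fixes A :: "nat \<Rightarrow> nat \<Rightarrow> real \<Rightarrow> real"
  assumes "\<And>k j. k < m \<Longrightarrow> j < m \<Longrightarrow> continuous_on S (A k j)"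
  shows "continuous_on S (\<lambda>x. cofactor (Matrix.mat m m (\<lambda>(k, j). A k j x)) i l)"
proof -
  have *: "mat_delete (Matrix.mat m m (\<lambda>(k, j). A k j x)) i l = Matrix.mat (m - 1) (m - 1)
      (\<lambda>(k, j). A (if k < i then k else Suc k) (if j < l then j else Suc j) x)" for x
    by (intro eq_matI) (auto simp: mat_delete_def)
  show ?thesis
    unfolding cofactor_def * using assms
    by (intro continuous_on_mult continuous_on_det continuous_on_const) auto
qed

subsection \<open>Variation of constants\<close>

text \<open>
  A jet is a sequence of functions \<open>F 0, F 1, \<dots>\<close> in which \<open>F k\<close> plays the role of the
  \<open>k\<close>-th derivative; \<open>U j k\<close> stands for the \<open>k\<close>-th derivative of \<open>u\<^sub>j\<close>.  In this notation the
  Widder derivative \<open>L\<^sub>m\<close> of \<open>F 0\<close> is \<open>jet_border U m F / jet_wronskian U m\<close>, also for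
  \<open>m = 0\<close>, where the denominator is an empty determinant.
\<close>

definition jet_wronskian :: "(nat \<Rightarrow> nat \<Rightarrow> real \<Rightarrow> real) \<Rightarrow> nat \<Rightarrow> real \<Rightarrow> real" where
  "jet_wronskian U m s = Determinant.det (Matrix.mat m m (\<lambda>(k, j). U j k s))"

definition jet_cofactor ::
  "(nat \<Rightarrow> nat \<Rightarrow> real \<Rightarrow> real) \<Rightarrow> nat \<Rightarrow> nat \<Rightarrow> nat \<Rightarrow> real \<Rightarrow> real" where
  "jet_cofactor U m k j s = cofactor (Matrix.mat m m (\<lambda>(k, j). U j k s)) k j"

text \<open>Treating the numerator of a Widder derivative as a Wronskian with \<open>F\<close> as
  last function makes facts about \<open>jet_wronskian\<close> apply to it.\<close>

abbreviation jet_border ::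
  "(nat \<Rightarrow> nat \<Rightarrow> real \<Rightarrow> real) \<Rightarrow> nat \<Rightarrow> (nat \<Rightarrow> real \<Rightarrow> real) \<Rightarrow> real \<Rightarrow> real" where
  "jet_border U m F \<equiv> jet_wronskian (\<lambda>j. if j < m then U j else F) (Suc m)"

text \<open>Not tied to iterated derivatives, so that the kernel with its second argument frozen, a
  linear combination of jets, is a jet directly.\<close>

definition is_jet :: "real set \<Rightarrow> nat \<Rightarrow> (nat \<Rightarrow> real \<Rightarrow> real) \<Rightarrow> bool" where
  "is_jet S m F \<longleftrightarrow>
    (\<forall>k<m. \<forall>s\<in>S. (F k has_real_derivative F (Suc k) s) (at s within S)) \<and> continuous_on S (F m)"

text \<open>
  By Cramer's rule these are the coordinates of \<open>(F 0, \<dots>, F (m - 1))\<close> with respect to the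
  columns of the Wronskian matrix.
\<close>

definition jet_coeff ::
  "(nat \<Rightarrow> nat \<Rightarrow> real \<Rightarrow> real) \<Rightarrow> nat \<Rightarrow> (nat \<Rightarrow> real \<Rightarrow> real) \<Rightarrow> nat \<Rightarrow> real \<Rightarrow> real" where
  "jet_coeff U m F j s = (\<Sum>k<m. jet_cofactor U m k j s * F k s) / jet_wronskian U m s"

lemma is_jetD:
  "is_jet S m F \<Longrightarrow> k < m \<Longrightarrow> s \<in> S \<Longrightarrow> (F k has_real_derivative F (Suc k) s) (at s within S)"
  by (simp add: is_jet_def)

lemma is_jet_continuous:
  assumes "is_jet S m F" "k \<le> m"
  shows "continuous_on S (F k)"
proof (cases "k = m")
  case True
  then show ?thesis using assms by (simp add: is_jet_def)
next
  case False
  then have "k < m" using assms by simp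
  then show ?thesis
    using assms by (metis DERIV_continuous_on is_jetD)
qed

lemma is_jet_mono: "is_jet S m F \<Longrightarrow> k \<le> m \<Longrightarrow> is_jet S k F"
  using is_jet_continuous[of S m F k] by (auto simp: is_jet_def)

lemma jet_coeff_solves:
  assumes "jet_wronskian U m s \<noteq> 0" "k < m"
  shows "(\<Sum>j<m. U j k s * jet_coeff U m F j s) = F k s"
proof -
  have "(\<Sum>j<m. U j k s * jet_coeff U m F j s) =
      (\<Sum>j<m. \<Sum>i<m. U j k s * jet_cofactor U m i j s * F i s) / jet_wronskian U m s"
    by (simp add: jet_coeff_def sum_divide_distrib sum_distrib_left mult.assoc)
  also have "(\<Sum>j<m. \<Sum>i<m. U j k s * jet_cofactor U m i j s * F i s) =
      (\<Sum>i<m. (\<Sum>j<m. U j k s * jet_cofactor U m i j s) * F i s)"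
    by (subst sum.swap) (simp add: sum_distrib_right)
  also have "\<dots> = (\<Sum>i<m. (if k = i then jet_wronskian U m s else 0) * F i s)"
    unfolding jet_cofactor_def jet_wronskian_def using assms
    by (intro sum.cong refl) (simp add: cofactor_mult_right[where A="\<lambda>k j. U j k s"])
  also have "\<dots> = (\<Sum>i<m. if k = i then jet_wronskian U m s * F i s else 0)"
    by (intro sum.cong) auto
  also have "\<dots> = jet_wronskian U m s * F k s"
    using assms(2) by simp
  finally show ?thesis using assms by simp
qed

lemma jet_coeff_unique:
  assumes "jet_wronskian U m s \<noteq> 0" "j < m"
    and "\<And>k. k < m \<Longrightarrow> (\<Sum>j<m. U j k s * p j) = F k s"
  shows "p j = jet_coeff U m F j s"
proof -
  have "(\<Sum>k<m. jet_cofactor U m k j s * F k s) = jet_wronskian U m s * p j"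
    using cofactor_mult_left[OF assms(2), of "\<lambda>k j. U j k s" p] assms(3)
    by (simp add: jet_cofactor_def jet_wronskian_def)
  then show ?thesis using assms(1) by (simp add: jet_coeff_def)
qed

text \<open>Cramer's rule for the last coordinate. In Widder's notation this is
  \<open>W\<^sub>i\<^sub>-\<^sub>1 L\<^sub>i F / W\<^sub>i\<close>, the quantity whose monotonicity
  drives the sign argument.\<close>

lemma jet_coeff_last:
  "jet_coeff U (Suc i) F i s = jet_border U i F s / jet_wronskian U (Suc i) s"
proof -
  have "Matrix.mat (Suc i) (Suc i) (\<lambda>(k, j). (if j < i then U j else F) k s) =
    Matrix.mat (Suc i) (Suc i) (\<lambda>(k, j). if j = i then F k s else U j k s)"
    by (intro eq_matI) auto
  then show ?thesis
    using cofactor_cramer[of i "Suc i" "\<lambda>k j. U j k s" "\<lambda>k. F k s"]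
    by (simp add: jet_coeff_def jet_cofactor_def jet_wronskian_def del: sum.lessThan_Suc)
qed

text \<open>With Cramer's coordinates in \<open>det_bordered\<close>, the Widder derivative becomes
  the defect of \<open>F m\<close> against the value predicted from lower orders.\<close>

lemma jet_border_eq:
  assumes "jet_wronskian U m s \<noteq> 0"
  shows "jet_border U m F s =
    jet_wronskian U m s * (F m s - (\<Sum>j<m. U j m s * jet_coeff U m F j s))"
proof -
  have "Matrix.mat (Suc m) (Suc m) (\<lambda>(k, j). (if j < m then U j else F) k s) =
    Matrix.mat (Suc m) (Suc m) (\<lambda>(k, j). if j < m then U j k s else F k s)"
    by (intro eq_matI) auto
  then show ?thesis
    using det_bordered[of m "\<lambda>k j. U j k s" "\<lambda>j. jet_coeff U m F j s" "\<lambda>k. F k s"]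
      jet_coeff_solves[OF assms]
    by (simp add: jet_wronskian_def)
qed

lemma jet_border_zero:
  assumes "\<And>k. k < m \<Longrightarrow> F k s = 0"
  shows "jet_border U m F s = F m s * jet_wronskian U m s"
proof -
  have "jet_border U m F s = F m s *
      Determinant.det (Matrix.mat m m (\<lambda>(k, j). (if j < m then U j else F) k s))"
    unfolding jet_wronskian_def
    by (subst det_last_column_zero) (use assms in auto)
  also have "Matrix.mat m m (\<lambda>(k, j). (if j < m then U j else F) k s) =
      Matrix.mat m m (\<lambda>(k, j). U j k s)"
    by (intro eq_matI) auto
  finally show ?thesis by (simp add: jet_wronskian_def)
qed

text \<open>
  Variation of constants: differentiating \<open>\<Sum>j. U j k * p j = F k\<close> for \<open>k < m\<close> shows that the
  Wronskian matrix maps \<open>p'\<close> to a multiple of the last unit vector.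
\<close>

lemma jet_coeff_has_derivative:
  assumes U: "\<And>j. j < m \<Longrightarrow> is_jet S m (U j)" and F: "is_jet S m F"
    and W: "\<And>s. s \<in> S \<Longrightarrow> jet_wronskian U m s \<noteq> 0"
    and "i < m" "s \<in> S" and limpt: "at s within S \<noteq> bot"
  shows "(jet_coeff U m F i has_real_derivative
    jet_cofactor U m (m - 1) i s / jet_wronskian U m s *
    (jet_border U m F s / jet_wronskian U m s)) (at s within S)"
proof -
  have diffU: "U j k differentiable (at s within S)" if "j < m" "k < m" for j k
    using is_jetD[OF U[OF that(1)] that(2) \<open>s \<in> S\<close>] real_differentiable_def by blast
  have diffF: "F k differentiable (at s within S)" if "k < m" for k
    using is_jetD[OF F that \<open>s \<in> S\<close>] real_differentiable_def by blast
  have "jet_wronskian U m differentiable (at s within S)"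
    unfolding jet_wronskian_def using diffU by (intro differentiable_det) auto
  moreover have "jet_cofactor U m k j differentiable (at s within S)" for k j
    unfolding jet_cofactor_def using diffU by (intro differentiable_cofactor) auto
  ultimately have "jet_coeff U m F j differentiable (at s within S)" for j
    unfolding jet_coeff_def using diffF W[OF \<open>s \<in> S\<close>]
    by (intro differentiable_divide differentiable_sum differentiable_mult) auto
  then obtain P' where P': "\<And>j. (jet_coeff U m F j has_real_derivative P' j) (at s within S)"
    unfolding real_differentiable_def by metis
  \<comment> \<open>Row \<open>k\<close> of the system is differentiated in two ways; the results
    agree because derivatives within \<open>S\<close> are unique at a limit point.\<close>
  have eq: "(\<Sum>j<m. U j k s * P' j) =
      F (Suc k) s - (\<Sum>j<m. U j (Suc k) s * jet_coeff U m F j s)" if k: "k < m" for k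
  proof -
    have "((\<lambda>s. \<Sum>j<m. U j k s * jet_coeff U m F j s) has_real_derivative
        (\<Sum>j<m. U j (Suc k) s * jet_coeff U m F j s + P' j * U j k s)) (at s within S)"
      using is_jetD[OF U k \<open>s \<in> S\<close>] P' by (intro DERIV_sum DERIV_mult) auto
    moreover have "((\<lambda>s. \<Sum>j<m. U j k s * jet_coeff U m F j s) has_real_derivative F (Suc k) s) (at s within S)"
      by (rule has_field_derivative_transform_within[where f="F k" and d=1])
        (use k W \<open>s \<in> S\<close> jet_coeff_solves is_jetD[OF F k] in auto)
    ultimately have "(\<Sum>j<m. U j (Suc k) s * jet_coeff U m F j s + P' j * U j k s) = F (Suc k) s"
      using limpt has_field_derivative_unique by blast
    then show ?thesis by (simp add: sum.distrib algebra_simps)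
  qed
  define h where "h = jet_border U m F s / jet_wronskian U m s"
  have h: "h = F m s - (\<Sum>j<m. U j m s * jet_coeff U m F j s)"
    unfolding h_def jet_border_eq[OF W[OF \<open>s \<in> S\<close>]] using W[OF \<open>s \<in> S\<close>] by simp
  \<comment> \<open>The right-hand side of the system for \<open>P'\<close>. Rows before the last
    give 0, since there the coordinates reproduce \<open>F (Suc k)\<close>; the last row leaves the
    Widder derivative \<open>h\<close>.\<close>
  define e where "e k = (if k = m - 1 then h else 0)" for k
  have "(\<Sum>j<m. U j k s * P' j) = e k" if k: "k < m" for k
  proof (cases "k = m - 1")
    case True
    then show ?thesis using eq[OF k] k h by (simp add: e_def)
  next
    case False
    then have "Suc k < m" using k by simp
    then show ?thesis using False eq[OF k] jet_coeff_solves[OF W[OF \<open>s \<in> S\<close>]] by (simp add: e_def)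
  qed
  then have "P' i = jet_coeff U m (\<lambda>k s. e k) i s"
    using W \<open>s \<in> S\<close> \<open>i < m\<close> by (intro jet_coeff_unique) auto
  also have "\<dots> = jet_cofactor U m (m - 1) i s / jet_wronskian U m s * h"
  proof -
    have "(\<Sum>k<m. jet_cofactor U m k i s * e k) =
        (\<Sum>k<m. if k = m - 1 then jet_cofactor U m k i s * h else 0)"
      by (intro sum.cong) (auto simp: e_def)
    also have "\<dots> = jet_cofactor U m (m - 1) i s * h"
      using \<open>i < m\<close> by simp
    finally show ?thesis by (simp add: jet_coeff_def)
  qed
  finally show ?thesis using P'[of i] by (simp add: h_def)
qed

subsection \<open>The Widder kernel\<close>

text \<open>The last coordinate \<open>W\<^sub>i\<^sub>-\<^sub>1 L\<^sub>i F / W\<^sub>i\<close> has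
  derivative \<open>(W\<^sub>i\<^sub>-\<^sub>1 / W\<^sub>i) L\<^sub>i\<^sub>+\<^sub>1 F\<close>,
  which is nonnegative, so it stays above its nonnegative value at \<open>t\<close>.\<close>

lemma jet_border_nonneg_descend:
  fixes a b :: real
  assumes U: "\<And>j. j \<le> i \<Longrightarrow> is_jet {a..b} (Suc i) (U j)" and F: "is_jet {a..b} (Suc i) F"
    and W: "\<And>m s. m \<le> Suc i \<Longrightarrow> s \<in> {a..b} \<Longrightarrow> jet_wronskian U m s > 0"
    and t: "a \<le> t" and s: "t \<le> s" "s \<le> b"
    and next_nonneg: "\<And>\<sigma>. \<sigma> \<in> {t..b} \<Longrightarrow> jet_border U (Suc i) F \<sigma> \<ge> 0"
    and init: "jet_border U i F t \<ge> 0"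
  shows "jet_border U i F s \<ge> 0"
\<comment> \<open>A one-point interval has no limit point, so derivatives within it carry no
  information; there \<open>s = t\<close>.\<close>
proof (cases "a < b")
  case False
  then have "s = t" using t s by auto
  then show ?thesis using init by simp
next
  case True
  let ?q = "jet_coeff U (Suc i) F i"
  have W0: "jet_wronskian U (Suc i) \<sigma> \<noteq> 0" if "\<sigma> \<in> {a..b}" for \<sigma>
    using W[of "Suc i" \<sigma>] that by simp
  have q': "(?q has_real_derivative jet_wronskian U i \<sigma> / jet_wronskian U (Suc i) \<sigma> *
      (jet_border U (Suc i) F \<sigma> / jet_wronskian U (Suc i) \<sigma>)) (at \<sigma> within {a..b})"
    if "\<sigma> \<in> {a..b}" for \<sigma>
    using jet_coeff_has_derivative[of "Suc i" "{a..b}" U F i \<sigma>] U F W0 that True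
    by (simp add: jet_cofactor_def cofactor_corner[where A="\<lambda>k j. U j k \<sigma>"]
        jet_wronskian_def[of U i \<sigma>] trivial_limit_within islimpt_Icc)
  have "?q t \<le> ?q s"
  proof (rule DERIV_nonneg_imp_increasing_open[OF s(1)])
    fix \<sigma> assume \<sigma>: "t < \<sigma>" "\<sigma> < s"
    then have "(?q has_real_derivative jet_wronskian U i \<sigma> / jet_wronskian U (Suc i) \<sigma> *
        (jet_border U (Suc i) F \<sigma> / jet_wronskian U (Suc i) \<sigma>)) (at \<sigma>)"
      using q'[of \<sigma>] t s by (simp add: at_within_Icc_at)
    moreover have "jet_wronskian U i \<sigma> / jet_wronskian U (Suc i) \<sigma> *
        (jet_border U (Suc i) F \<sigma> / jet_wronskian U (Suc i) \<sigma>) \<ge> 0"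
      using W[of i \<sigma>] W[of "Suc i" \<sigma>] next_nonneg[of \<sigma>] \<sigma> t s by simp
    ultimately show "\<exists>y. (?q has_real_derivative y) (at \<sigma>) \<and> 0 \<le> y" by blast
  next
    have "continuous_on {a..b} ?q" using q' by (rule DERIV_continuous_on)
    then show "continuous_on {t..s} ?q" using t s by (auto intro: continuous_on_subset)
  qed
  then have "0 \<le> ?q s"
    using init W[of "Suc i" t] t s unfolding jet_coeff_last
    by (smt (verit) atLeastAtMost_iff divide_nonneg_pos order_refl)
  then show ?thesis
    using W[of "Suc i" s] t s by (simp add: jet_coeff_last zero_le_divide_iff)
qed

text \<open>For \<open>m = Suc n\<close> these are the coefficients of the \<open>u\<^sub>j\<close>
  in \<open>g\<^sub>n(\<cdot>, t)\<close>, obtained by expanding its determinant along the last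
  row.\<close>

definition jet_kernel_coeff ::
  "(nat \<Rightarrow> nat \<Rightarrow> real \<Rightarrow> real) \<Rightarrow> nat \<Rightarrow> nat \<Rightarrow> real \<Rightarrow> real" where
  "jet_kernel_coeff U m j t = jet_cofactor U m (m - 1) j t / jet_wronskian U m t"

text \<open>These are the initial values of the kernel in its first argument: at \<open>t\<close>
  all derivatives below order \<open>m - 1\<close> vanish, and that of order \<open>m - 1\<close> is
  1.\<close>

lemma jet_kernel_diagonal:
  assumes "jet_wronskian U m t \<noteq> 0" "k < m"
  shows "(\<Sum>j<m. U j k t * jet_kernel_coeff U m j t) = (if k = m - 1 then 1 else 0)"
proof -
  have "(\<Sum>j<m. U j k t * jet_kernel_coeff U m j t) =
      (\<Sum>j<m. U j k t * jet_cofactor U m (m - 1) j t) / jet_wronskian U m t"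
    by (simp add: jet_kernel_coeff_def sum_divide_distrib)
  also have "(\<Sum>j<m. U j k t * jet_cofactor U m (m - 1) j t) =
      (if k = m - 1 then jet_wronskian U m t else 0)"
    unfolding jet_cofactor_def jet_wronskian_def using assms(2)
    by (intro cofactor_mult_right[where A="\<lambda>k j. U j k t"]) auto
  finally show ?thesis using assms(1) by simp
qed

lemma is_jet_lincomb:
  assumes "\<And>j. j \<in> J \<Longrightarrow> is_jet S m (U j)"
  shows "is_jet S m (\<lambda>k s. \<Sum>j\<in>J. U j k s * c j)"
  unfolding is_jet_def
proof (intro conjI allI impI ballI)
  show "((\<lambda>s. \<Sum>j\<in>J. U j k s * c j) has_real_derivative (\<Sum>j\<in>J. U j (Suc k) s * c j)) (at s within S)"
    if "k < m" "s \<in> S" for k s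
    using is_jetD[OF assms that] by (intro DERIV_sum DERIV_cmult_right)
  show "continuous_on S (\<lambda>s. \<Sum>j\<in>J. U j m s * c j)"
    using is_jet_continuous[OF assms order_refl] by (intro continuous_intros)
qed

text \<open>With \<open>t\<close> frozen the kernel is a combination \<open>G\<close> of the
  \<open>U j\<close>, so its last coordinate is a constant, positive by its value at
  \<open>t\<close>. The sign then descends from order \<open>n\<close> to order 0, where the
  bordered determinant is \<open>G\<close> itself.\<close>

lemma jet_kernel_nonneg:
  fixes a b :: real
  assumes U: "\<And>j. j < m \<Longrightarrow> is_jet {a..b} m (U j)"
    and W: "\<And>k s. k \<le> m \<Longrightarrow> s \<in> {a..b} \<Longrightarrow> jet_wronskian U k s > 0"
    and "m > 0" and t: "a \<le> t" and s: "t \<le> s" "s \<le> b"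
  shows "(\<Sum>j<m. U j 0 s * jet_kernel_coeff U m j t) \<ge> 0"
proof -
  define G where "G k s = (\<Sum>j<m. U j k s * jet_kernel_coeff U m j t)" for k s
  obtain n where m: "m = Suc n" using \<open>m > 0\<close> gr0_implies_Suc by blast
  have jetG: "is_jet {a..b} m G"
    unfolding G_def using U by (intro is_jet_lincomb) auto
  have Gt: "G k t = (if k = n then 1 else 0)" if "k < m" for k
    unfolding G_def using jet_kernel_diagonal[of U m t k] that W[of m t] t s by (simp add: m)
  have top: "jet_border U n G \<sigma> \<ge> 0" if "\<sigma> \<in> {t..b}" for \<sigma>
  proof -
    have pos: "jet_wronskian U m \<sigma> > 0" "jet_wronskian U m t > 0" "jet_wronskian U n t > 0"
      using W[of m] W[of n t] that t s by (auto simp: m)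
    then have "jet_coeff U m G n \<sigma> = jet_kernel_coeff U m n t"
      by (intro jet_coeff_unique[symmetric]) (auto simp: m G_def)
    also have "\<dots> = jet_wronskian U n t / jet_wronskian U m t"
      by (simp add: jet_kernel_coeff_def jet_cofactor_def m 
        cofactor_corner[where A="\<lambda>k j. U j k t"] jet_wronskian_def[of U n])
    finally have "jet_border U n G \<sigma> / jet_wronskian U m \<sigma> > 0"
      using pos by (simp add: m jet_coeff_last)
    then show ?thesis using pos by (simp add: zero_less_divide_iff)
  qed
  \<comment> \<open>\<open>inc_induct\<close> runs downward from \<open>n\<close>: each step goes
    from \<open>Suc i\<close> to \<open>i\<close>, starting at \<open>t\<close> from the value 0
    supplied by \<open>Gt\<close>.\<close>
  have "\<forall>\<sigma>\<in>{t..b}. jet_border U i G \<sigma> \<ge> 0" if "i \<le> n" for i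
    using that
  proof (induction rule: inc_induct)
    case base
    then show ?case using top by blast
  next
    case (step i)
    show ?case
    proof
      fix \<sigma> assume \<sigma>: "\<sigma> \<in> {t..b}"
      have init: "jet_border U i G t = 0"
        using Gt step.hyps by (subst jet_border_zero) (auto simp: m)
      show "jet_border U i G \<sigma> \<ge> 0"
        by (rule jet_border_nonneg_descend[of i a b U G t])
          (use \<sigma> init step.hyps step.IH W t is_jet_mono[OF U, of _ "Suc i"] is_jet_mono[OF jetG, of "Suc i"]
            in \<open>auto simp: m\<close>)
    qed
  qed
  from this[of 0] have "jet_border U 0 G s \<ge> 0" using s by simp
  moreover have "jet_border U 0 G s = G 0 s"
    by (subst jet_border_zero) (auto simp: jet_wronskian_def)
  ultimately show ?thesis by (simp add: G_def)
qed

text \<open>The conditions are triangular: once the lower orders vanish, the bordered determinant is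
  \<open>F k a\<close> times a nonzero Wronskian.\<close>

lemma jet_initial_zero:
  assumes "\<And>i. i < m \<Longrightarrow> jet_border U i F a = 0" "\<And>i. i < m \<Longrightarrow> jet_wronskian U i a \<noteq> 0"
  shows "k < m \<Longrightarrow> F k a = 0"
proof (induction k rule: less_induct)
  case (less k)
  then have "jet_border U k F a = F k a * jet_wronskian U k a"
    by (intro jet_border_zero) auto
  then show ?case using assms less.prems by auto
qed

lemma continuous_on_jet_wronskian:
  assumes "\<And>j k. j < m \<Longrightarrow> k < m \<Longrightarrow> continuous_on S (U j k)"
  shows "continuous_on S (jet_wronskian U m)"
  unfolding jet_wronskian_def using assms by (intro continuous_on_det) auto

lemma continuous_on_jet_kernel_coeff:
  assumes "\<And>j k. j < m \<Longrightarrow> k < m \<Longrightarrow> continuous_on S (U j k)"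
    and "\<And>s. s \<in> S \<Longrightarrow> jet_wronskian U m s \<noteq> 0"
  shows "continuous_on S (jet_kernel_coeff U m j)"
  unfolding jet_kernel_coeff_def jet_cofactor_def
  using assms continuous_on_jet_wronskian[OF assms(1)] 
  by (intro continuous_on_divide continuous_on_cofactor) auto

text \<open>All coordinates vanish at \<open>a\<close>, so each is the integral of its derivative;
  summing against \<open>U j 0 s\<close>, constant in the integration variable, reassembles
  \<open>F 0 s\<close>.\<close>

lemma widder_taylor:
  fixes a b :: real
  assumes "a < b" and U: "\<And>j. j < m \<Longrightarrow> is_jet {a..b} m (U j)" and F: "is_jet {a..b} m F"
    and W: "\<And>s. s \<in> {a..b} \<Longrightarrow> jet_wronskian U m s \<noteq> 0"
    and init: "\<And>k. k < m \<Longrightarrow> F k a = 0"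
    and "m > 0" and s: "s \<in> {a..b}"
  shows "((\<lambda>t. (\<Sum>j<m. U j 0 s * jet_kernel_coeff U m j t) *
    (jet_border U m F t / jet_wronskian U m t)) has_integral F 0 s) {a..s}"
proof -
  have "((\<lambda>t. jet_kernel_coeff U m j t * (jet_border U m F t / jet_wronskian U m t))
      has_integral jet_coeff U m F j s) {a..s}" if "j < m" for j
  proof -
    have "(jet_coeff U m F j has_vector_derivative
        jet_kernel_coeff U m j t * (jet_border U m F t / jet_wronskian U m t)) (at t within {a..s})"
      if t: "t \<in> {a..s}" for t
    proof -
      have "(jet_coeff U m F j has_real_derivative
          jet_kernel_coeff U m j t * (jet_border U m F t / jet_wronskian U m t)) (at t within {a..b})"
        unfolding jet_kernel_coeff_def using U F W \<open>j < m\<close> \<open>a < b\<close> t s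
        by (intro jet_coeff_has_derivative) (auto simp: trivial_limit_within islimpt_Icc)
      then show ?thesis
        using s by (auto simp: has_real_derivative_iff_has_vector_derivative
            intro: has_vector_derivative_within_subset)
    qed
    then have "((\<lambda>t. jet_kernel_coeff U m j t * (jet_border U m F t / jet_wronskian U m t))
      has_integral jet_coeff U m F j s - jet_coeff U m F j a) {a..s}"
      using s by (intro fundamental_theorem_of_calculus) auto
    moreover have "jet_coeff U m F j a = 0" using init by (simp add: jet_coeff_def)
    ultimately show ?thesis by simp
  qed
  then have "((\<lambda>t. \<Sum>j<m. U j 0 s * (jet_kernel_coeff U m j t *
      (jet_border U m F t / jet_wronskian U m t))) has_integral
      (\<Sum>j<m. U j 0 s * jet_coeff U m F j s)) {a..s}"
    by (intro has_integral_sum has_integral_mult_right) auto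
  also have "(\<Sum>j<m. U j 0 s * jet_coeff U m F j s) = F 0 s"
    using W[OF s] \<open>m > 0\<close> by (rule jet_coeff_solves)
  finally show ?thesis by (simp only: sum_distrib_right mult.assoc)
qed

subsection \<open>An Opial inequality for kernels\<close>

lemma continuous_on_powr_nonneg:
  fixes f :: "'a::topological_space \<Rightarrow> real"
  assumes "continuous_on S f" "\<And>x. x \<in> S \<Longrightarrow> f x \<ge> 0" "p > 0"
  shows "continuous_on S (\<lambda>x. f x powr p)"
  using assms by (intro continuous_on_powr') auto

text \<open>A nonintegrable function has integral 0 by convention, so signs can be read off before
  integrability is known.\<close>

lemma integral_nonneg_total:
  fixes f :: "'a::euclidean_space \<Rightarrow> real"
  assumes "\<And>t. t \<in> S \<Longrightarrow> f t \<ge> 0"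
  shows "integral S f \<ge> 0"
  using assms by (cases "f integrable_on S") (auto intro: integral_nonneg simp: not_integrable_integral)

text \<open>Young's inequality, applied pointwise to \<open>f\<close> and \<open>g\<close> divided
  by their norms and then integrated.\<close>

lemma Holder_integral:
  fixes f g :: "real \<Rightarrow> real"
  assumes "c \<le> d" and pq: "p > 1" "q > 1" "1 / p + 1 / q = 1"
    and f: "continuous_on {c..d} f" "\<And>t. t \<in> {c..d} \<Longrightarrow> f t \<ge> 0"
    and g: "continuous_on {c..d} g" "\<And>t. t \<in> {c..d} \<Longrightarrow> g t \<ge> 0"
  shows "integral {c..d} (\<lambda>t. f t * g t) \<le>
    integral {c..d} (\<lambda>t. f t powr p) powr (1 / p) * integral {c..d} (\<lambda>t. g t powr q) powr (1 / q)"
proof (cases "c < d")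
  case False
  then show ?thesis using \<open>c \<le> d\<close> by simp
next
  case True
  define X where "X = integral {c..d} (\<lambda>t. f t powr p)"
  define Y where "Y = integral {c..d} (\<lambda>t. g t powr q)"
  have cf: "continuous_on {c..d} (\<lambda>t. f t powr p)" and cg: "continuous_on {c..d} (\<lambda>t. g t powr q)"
    using f g pq by (auto intro!: continuous_on_powr_nonneg)
  have "X \<ge> 0" "Y \<ge> 0"
    by (auto simp: X_def Y_def intro!: integral_nonneg_total)
  \<comment> \<open>Normalisation fails if a norm is 0, but then continuity forces that function to
    vanish on the whole interval.\<close>
  consider "X = 0" | "Y = 0" | "X > 0" "Y > 0"
    using \<open>X \<ge> 0\<close> \<open>Y \<ge> 0\<close> by linarith
  then show ?thesis
  proof cases
    case 1
    then have "f t = 0" if "t \<in> {c..d}" for t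
      using integral_eq_0_iff[OF cf True] that unfolding X_def by auto
    then have "integral {c..d} (\<lambda>t. f t * g t) = integral {c..d} (\<lambda>t. 0)"
      by (intro integral_cong) auto
    then show ?thesis by simp
  next
    case 2
    then have "g t = 0" if "t \<in> {c..d}" for t
      using integral_eq_0_iff[OF cg True] that unfolding Y_def by auto
    then have "integral {c..d} (\<lambda>t. f t * g t) = integral {c..d} (\<lambda>t. 0)"
      by (intro integral_cong) auto
    then show ?thesis by simp
  next
    case 3
    define Z where "Z = X powr (1 / p) * Y powr (1 / q)"
    have Z: "Z > 0" using 3 by (simp add: Z_def)
    have pw: "f t * g t / Z \<le> f t powr p / (X * p) + g t powr q / (Y * q)" if "t \<in> {c..d}" for t
    proof -
      have "f t * g t / Z = (f t / X powr (1 / p)) * (g t / Y powr (1 / q))"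
        by (simp add: Z_def)
      also have "\<dots> \<le> (f t / X powr (1 / p)) powr p / p + (g t / Y powr (1 / q)) powr q / q"
        using pq f(2) g(2) that by (intro Youngs_inequality) auto
      finally show ?thesis
        using 3 pq f(2) g(2) that by (simp add: powr_divide powr_powr)
    qed
    have "integral {c..d} (\<lambda>t. f t * g t / Z) \<le>
        integral {c..d} (\<lambda>t. f t powr p / (X * p) + g t powr q / (Y * q))"
      using 3 Z pq by (intro integral_le pw integrable_continuous_real continuous_on_add
        continuous_on_divide continuous_on_mult continuous_on_const cf cg f(1) g(1)) auto
    also have "\<dots> = X / (X * p) + Y / (Y * q)"
      using 3 pq by (subst integral_add) (auto intro!: integrable_continuous_real continuous_on_divide
        cf cg simp: X_def[symmetric] Y_def[symmetric])
    also have "\<dots> = 1" using 3 pq by simp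
    finally have "integral {c..d} (\<lambda>t. f t * g t) / Z \<le> 1" by simp
    then show ?thesis using Z by (simp add: Z_def X_def Y_def divide_le_eq)
  qed
qed

text \<open>
  Shifting the antiderivative by \<open>\<epsilon> > 0\<close> avoids differentiating the power at zeros of the
  antiderivative.
\<close>

lemma integral_antiderivative_powr_le:
  fixes h :: "real \<Rightarrow> real"
  assumes "a \<le> x" "\<gamma> > 0" and h: "continuous_on {a..x} h" "\<And>t. t \<in> {a..x} \<Longrightarrow> h t \<ge> 0"
  shows "integral {a..x} (\<lambda>s. integral {a..s} h powr \<gamma> * h s) \<le>
    integral {a..x} h powr (\<gamma> + 1) / (\<gamma> + 1)"
proof -
  define z where "z s = integral {a..s} h" for s
  have z': "(z has_real_derivative h s) (at s within {a..x})" if "s \<in> {a..x}" for s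
    unfolding z_def using h(1) that by (rule integral_has_real_derivative)
  have cz: "continuous_on {a..x} z" using z' by (rule DERIV_continuous_on)
  have z0: "z s \<ge> 0" if "s \<in> {a..x}" for s
    unfolding z_def using h that by (intro integral_nonneg_total) auto
  have "integral {a..x} (\<lambda>s. z s powr \<gamma> * h s) \<le> (z x + \<epsilon>) powr (\<gamma> + 1) / (\<gamma> + 1)" if "\<epsilon> > 0" for \<epsilon>
  proof -
    have "((\<lambda>s. (z s + \<epsilon>) powr (\<gamma> + 1) / (\<gamma> + 1)) has_vector_derivative (z s + \<epsilon>) powr \<gamma> * h s)
        (at s within {a..x})" if "s \<in> {a..x}" for s
    proof -
      have "((\<lambda>s. z s + \<epsilon>) has_real_derivative h s) (at s within {a..x})"
        using z'[OF that] by (auto intro!: derivative_eq_intros)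
      from DERIV_cdivide[OF DERIV_chain2[OF has_real_derivative_powr this], of "\<gamma> + 1" "\<gamma> + 1"]
      show ?thesis
        using z0[OF that] \<open>\<epsilon> > 0\<close> \<open>\<gamma> > 0\<close>
        by (simp add: has_real_derivative_iff_has_vector_derivative)
    qed
    then have "((\<lambda>s. (z s + \<epsilon>) powr \<gamma> * h s) has_integral
        (z x + \<epsilon>) powr (\<gamma> + 1) / (\<gamma> + 1) - (z a + \<epsilon>) powr (\<gamma> + 1) / (\<gamma> + 1)) {a..x}"
      by (intro fundamental_theorem_of_calculus \<open>a \<le> x\<close>) auto
    moreover have "(\<lambda>s. z s powr \<gamma> * h s) integrable_on {a..x}"
      using \<open>\<gamma> > 0\<close> cz z0 h by (intro integrable_continuous_real continuous_on_mult
        continuous_on_powr_nonneg) auto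
    ultimately have "integral {a..x} (\<lambda>s. z s powr \<gamma> * h s) \<le>
        (z x + \<epsilon>) powr (\<gamma> + 1) / (\<gamma> + 1) - (z a + \<epsilon>) powr (\<gamma> + 1) / (\<gamma> + 1)"
      using \<open>\<gamma> > 0\<close> \<open>\<epsilon> > 0\<close> z0 h(2)
      by (intro has_integral_le[OF integrable_integral]) (auto intro!: mult_right_mono powr_mono2)
    moreover have "(z a + \<epsilon>) powr (\<gamma> + 1) / (\<gamma> + 1) \<ge> 0" using \<open>\<gamma> > 0\<close> by simp
    ultimately show ?thesis by linarith
  qed
  then have "\<forall>\<^sub>F \<epsilon> in at_right 0.
      integral {a..x} (\<lambda>s. z s powr \<gamma> * h s) \<le> (z x + \<epsilon>) powr (\<gamma> + 1) / (\<gamma> + 1)"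
    by (simp add: eventually_at_right_less eventually_mono[OF eventually_at_right_less])
  \<comment> \<open>Since \<open>z x\<close> may be 0, the limit relies on a positive exponent and
    an eventually nonnegative base.\<close>
  moreover have "((\<lambda>\<epsilon>. (z x + \<epsilon>) powr (\<gamma> + 1) / (\<gamma> + 1)) \<longlongrightarrow> (z x + 0) powr (\<gamma> + 1) / (\<gamma> + 1))
      (at_right 0)"
    using \<open>\<gamma> > 0\<close> z0[of x] \<open>a \<le> x\<close>
    by (intro tendsto_divide tendsto_powr2 tendsto_add tendsto_const tendsto_ident_at)
      (auto intro: eventually_mono[OF eventually_at_right_less])
  ultimately have "integral {a..x} (\<lambda>s. z s powr \<gamma> * h s) \<le> (z x + 0) powr (\<gamma> + 1) / (\<gamma> + 1)"
    by (intro tendsto_lowerbound[OF _ _ trivial_limit_at_right_real])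
  then show ?thesis by (simp add: z_def)
qed

lemma continuous_on_slice:
  assumes "continuous_on (A \<times> B) (\<lambda>(s, t). h s t)" "s \<in> A"
  shows "continuous_on B (h s)"
proof -
  have "continuous_on B (Pair s)"
    by (intro continuous_on_Pair[OF continuous_on_const continuous_on_id])
  from continuous_on_compose2[OF assms(1) this] show ?thesis using assms(2) by auto
qed

text \<open>The substitution \<open>t = a + (s - a) * \<tau>\<close> replaces the moving interval by
  \<open>{0..1}\<close>, leaving a parameter integral over a fixed compact interval.\<close>

lemma continuous_on_integral_triangle:
  fixes h :: "real \<Rightarrow> real \<Rightarrow> real"
  assumes h: "continuous_on ({a..b} \<times> {a..b}) (\<lambda>(s, t). h s t)"
  shows "continuous_on {a..b} (\<lambda>s. integral {a..s} (h s))"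
proof -
  have segment: "a + (s - a) * \<tau> \<in> {a..s}" if "a \<le> s" "\<tau> \<in> {0..1}" for s \<tau>
    using that mult_left_le[of \<tau> "s - a"] by simp
  have "integral {a..s} (h s) = integral {0..1} (\<lambda>\<tau>. (s - a) * h s (a + (s - a) * \<tau>))"
    if s: "s \<in> {a..b}" for s
  proof -
    have cont: "continuous_on {a..s} (h s)"
      using continuous_on_subset[OF continuous_on_slice[OF h s], of "{a..s}"] s by simp
    have "((\<lambda>\<tau>. (s - a) *\<^sub>R h s (a + (s - a) * \<tau>)) has_integral
        integral {a + (s - a) * 0..a + (s - a) * 1} (h s)) {0..1}"
    proof (rule has_integral_substitution[OF _ _ _ cont])
      show "(\<lambda>\<tau>. a + (s - a) * \<tau>) ` {0..1} \<subseteq> {a..s}"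
        using s segment by (intro image_subsetI) simp
    qed (use s in \<open>auto intro!: derivative_eq_intros\<close>)
    then show ?thesis by (auto dest: integral_unique)
  qed
  moreover have "continuous_on {a..b} (\<lambda>s. integral (cbox 0 1) (\<lambda>\<tau>. (s - a) * h s (a + (s - a) * \<tau>)))"
  proof (rule integral_continuous_on_param)
    have "a + (s - a) * \<tau> \<in> {a..b}" if "s \<in> {a..b}" "\<tau> \<in> {0..1}" for s \<tau>
      using segment[of s \<tau>] that by simp
    then show "continuous_on ({a..b} \<times> cbox 0 1) (\<lambda>(s, \<tau>). (s - a) * h s (a + (s - a) * \<tau>))"
      unfolding case_prod_unfold
      by (intro continuous_intros continuous_on_compose2[OF h[unfolded case_prod_unfold],
            where f="\<lambda>x. (fst x, a + (fst x - a) * snd x)", simplified]) auto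
  qed
  ultimately show ?thesis
    using continuous_on_cong[OF refl, of "{a..b}" "\<lambda>s. integral {a..s} (h s)"] by simp
qed


text \<open>Here \<open>K\<close>, \<open>y\<close> and \<open>f\<close> stand for
  \<open>g\<^sub>n\<close>, \<open>|L\<^sub>n\<^sub>+\<^sub>1 f|\<close> and \<open>|f|\<close>; the
  Taylor formula enters only as the integral bound on \<open>f\<close>.\<close>

lemma opial_kernel:
  fixes a x \<alpha> \<beta> r :: real and f u v y :: "real \<Rightarrow> real" and K :: "real \<Rightarrow> real \<Rightarrow> real"
  assumes "a \<le> x" "\<alpha> > 0" "\<beta> > 0" "r > 1" "r > \<alpha>"
    and u: "continuous_on {a..x} u" "\<And>s. s \<in> {a..x} \<Longrightarrow> u s \<ge> 0"
    and v: "continuous_on {a..x} v" "\<And>s. s \<in> {a..x} \<Longrightarrow> v s > 0"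
    and y: "continuous_on {a..x} y" "\<And>s. s \<in> {a..x} \<Longrightarrow> y s \<ge> 0"
    and K: "continuous_on ({a..x} \<times> {a..x}) (\<lambda>(s, t). K s t)"
      "\<And>s t. a \<le> t \<Longrightarrow> t \<le> s \<Longrightarrow> s \<le> x \<Longrightarrow> K s t \<ge> 0"
    and f: "continuous_on {a..x} f" "\<And>s. s \<in> {a..x} \<Longrightarrow> f s \<ge> 0"
      "\<And>s. s \<in> {a..x} \<Longrightarrow> f s \<le> integral {a..s} (\<lambda>t. K s t * y t)"
  defines "P \<equiv> \<lambda>s. integral {a..s} (\<lambda>t. v t powr (- (1 / (r - 1))) * K s t powr (r / (r - 1)))"
  shows "integral {a..x} (\<lambda>s. u s * f s powr \<beta> * y s powr \<alpha>) \<le>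
    (\<alpha> / (\<alpha> + \<beta>)) powr (\<alpha> / r) *
    integral {a..x} (\<lambda>s. (u s powr r * v s powr (- \<alpha>)) powr (1 / (r - \<alpha>)) *
      P s powr (\<beta> * (r - 1) / (r - \<alpha>))) powr ((r - \<alpha>) / r) *
    integral {a..x} (\<lambda>s. v s * y s powr r) powr ((\<alpha> + \<beta>) / r)"
proof -
  define h where "h s = v s * y s powr r" for s
  define z where "z s = integral {a..s} h" for s
  have r: "r > 0" "r - 1 > 0" "r - \<alpha> > 0" using assms by auto
  have hc: "continuous_on {a..x} h"
    unfolding h_def using v y r
    by (intro continuous_on_mult continuous_on_powr_nonneg) auto
  have h0: "h s \<ge> 0" if "s \<in> {a..x}" for s
    unfolding h_def using v(2)[OF that] by simp
  have zc: "continuous_on {a..x} z"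
    unfolding z_def using hc by (intro indefinite_integral_continuous_1 integrable_continuous_real)
  have z0: "z s \<ge> 0" if "s \<in> {a..x}" for s
    unfolding z_def using h0 that by (intro integral_nonneg_total) auto
  have vp: "continuous_on {a..x} (\<lambda>s. v s powr c)" for c
    using v by (intro continuous_on_powr continuous_on_const) fastforce+
  have P: "continuous_on {a..x} P"
  proof -
    \<comment> \<open>Above the diagonal \<open>K\<close> may be negative. Truncating at 0 changes
      nothing for \<open>t \<le> s\<close> and makes the power continuous on the whole
      square.\<close>
    have "P s = integral {a..s} (\<lambda>t. v t powr (- (1 / (r - 1))) * max (K s t) 0 powr (r / (r - 1)))"
      if "s \<in> {a..x}" for s
      unfolding P_def using K(2) that by (intro integral_cong) (auto simp: max_def antisym)
    moreover have "continuous_on {a..x} (\<lambda>s. integral {a..s}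
        (\<lambda>t. v t powr (- (1 / (r - 1))) * max (K s t) 0 powr (r / (r - 1))))"
      using K(1) r
      by (intro continuous_on_integral_triangle)
        (auto simp: case_prod_unfold intro!: continuous_on_mult continuous_on_powr_nonneg
          continuous_on_max continuous_on_const continuous_on_compose2[OF vp] continuous_on_snd continuous_on_id)
    ultimately show ?thesis using continuous_on_cong[OF refl, of "{a..x}" P] by simp
  qed
  have P0: "P s \<ge> 0" if "s \<in> {a..x}" for s
    unfolding P_def
    by (rule integral_nonneg_total) simp
  have fle: "f s \<le> P s powr ((r - 1) / r) * z s powr (1 / r)" if s: "s \<in> {a..x}" for s
  proof -
    have sub: "continuous_on {a..s} g" if "continuous_on {a..x} g" for g :: "real \<Rightarrow> real"
      using that s by (auto intro: continuous_on_subset)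
    have Ks: "continuous_on {a..s} (K s)"
      by (intro sub continuous_on_slice[OF K(1) s])
    \<comment> \<open>The inserted powers of \<open>v\<close> cancel; they are chosen so that the
      Hoelder powers \<open>r / (r - 1)\<close> and \<open>r\<close> of the two factors are the
      integrand of \<open>P\<close> and \<open>h\<close>.\<close>
    have "integral {a..s} (\<lambda>t. K s t * y t) =
        integral {a..s} (\<lambda>t. (v t powr (- (1 / r)) * K s t) * (v t powr (1 / r) * y t))"
      using v(2) s by (intro integral_cong) (simp add: powr_minus less_imp_neq[symmetric])
    also have "\<dots> \<le> integral {a..s} (\<lambda>t. (v t powr (- (1 / r)) * K s t) powr (r / (r - 1)))
          powr (1 / (r / (r - 1))) *
        integral {a..s} (\<lambda>t. (v t powr (1 / r) * y t) powr r) powr (1 / r)"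
      using s r K(2) y(2) \<open>r > 1\<close>
      by (intro Holder_integral continuous_on_mult sub vp Ks y(1)) (auto simp: field_simps)
    also have "integral {a..s} (\<lambda>t. (v t powr (- (1 / r)) * K s t) powr (r / (r - 1))) = P s"
      unfolding P_def using r s K(2)
      by (intro integral_cong) (simp add: powr_mult powr_powr)
    also have "integral {a..s} (\<lambda>t. (v t powr (1 / r) * y t) powr r) = z s"
      unfolding z_def h_def using r s v(2) y(2)
      by (intro integral_cong) (simp add: powr_mult powr_powr less_imp_le)
    finally show ?thesis using f(3)[OF s] by simp
  qed
  \<comment> \<open>The split is adapted to the exponents \<open>r / (r - \<alpha>)\<close> and
    \<open>r / \<alpha>\<close>: the power of \<open>A\<close> is the integrand of the constant, and
    that of \<open>B\<close> is \<open>z powr (\<beta> / \<alpha>) * h\<close>, where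
    \<open>h\<close> is the derivative of \<open>z\<close>.\<close>
  define A where "A s = u s * v s powr (- (\<alpha> / r)) * P s powr (\<beta> * (r - 1) / r)" for s
  define B where "B s = z s powr (\<beta> / r) * h s powr (\<alpha> / r)" for s
  have Ac: "continuous_on {a..x} A"
    unfolding A_def using P P0 r \<open>\<beta> > 0\<close>
    by (intro continuous_on_mult[OF continuous_on_mult[OF u(1) vp]] continuous_on_powr_nonneg) auto
  have A0: "A s \<ge> 0" if "s \<in> {a..x}" for s
    unfolding A_def using u(2)[OF that] by simp
  have Bc: "continuous_on {a..x} B"
    unfolding B_def using zc z0 hc h0 r \<open>\<alpha> > 0\<close> \<open>\<beta> > 0\<close>
    by (intro continuous_on_mult continuous_on_powr_nonneg) auto
  have B0: "B s \<ge> 0" if "s \<in> {a..x}" for s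
    unfolding B_def by simp
  have "u s * f s powr \<beta> * y s powr \<alpha> \<le> A s * B s" if s: "s \<in> {a..x}" for s
  proof -
    have "f s powr \<beta> \<le> (P s powr ((r - 1) / r) * z s powr (1 / r)) powr \<beta>"
      using fle[OF s] f(2)[OF s] \<open>\<beta> > 0\<close> by (intro powr_mono2) auto
    also have "\<dots> = P s powr (\<beta> * (r - 1) / r) * z s powr (\<beta> / r)"
      by (simp add: powr_mult powr_powr mult.commute)
    finally have "u s * f s powr \<beta> * y s powr \<alpha> \<le>
        u s * (P s powr (\<beta> * (r - 1) / r) * z s powr (\<beta> / r)) * y s powr \<alpha>"
      using u(2)[OF s] by (intro mult_right_mono mult_left_mono) auto
    moreover have "y s powr \<alpha> = v s powr (- (\<alpha> / r)) * h s powr (\<alpha> / r)"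
      using r v(2)[OF s] y(2)[OF s]
      by (simp add: h_def powr_mult powr_powr powr_minus less_imp_le less_imp_neq[symmetric])
    then have "u s * (P s powr (\<beta> * (r - 1) / r) * z s powr (\<beta> / r)) * y s powr \<alpha> = A s * B s"
      by (simp add: A_def B_def mult_ac)
    ultimately show ?thesis by simp
  qed
  then have "integral {a..x} (\<lambda>s. u s * f s powr \<beta> * y s powr \<alpha>) \<le> integral {a..x} (\<lambda>s. A s * B s)"
    using \<open>a \<le> x\<close> Ac Bc u(1) f(1,2) y \<open>\<alpha> > 0\<close> \<open>\<beta> > 0\<close>
    by (intro integral_le integrable_continuous_real continuous_on_mult continuous_on_powr_nonneg) auto
  also have "\<dots> \<le> integral {a..x} (\<lambda>s. A s powr (r / (r - \<alpha>))) powr (1 / (r / (r - \<alpha>))) *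
      integral {a..x} (\<lambda>s. B s powr (r / \<alpha>)) powr (1 / (r / \<alpha>))"
    using \<open>a \<le> x\<close> Ac A0 Bc B0 r \<open>\<alpha> > 0\<close> by (intro Holder_integral) (auto simp: field_simps)
  also have "integral {a..x} (\<lambda>s. A s powr (r / (r - \<alpha>))) =
      integral {a..x} (\<lambda>s. (u s powr r * v s powr (- \<alpha>)) powr (1 / (r - \<alpha>)) *
        P s powr (\<beta> * (r - 1) / (r - \<alpha>)))"
    unfolding A_def using r u(2) P0
    by (intro integral_cong) (simp add: powr_mult powr_powr)
  also have "integral {a..x} (\<lambda>s. B s powr (r / \<alpha>)) = integral {a..x} (\<lambda>s. z s powr (\<beta> / \<alpha>) * h s)"
    unfolding B_def using r \<open>\<alpha> > 0\<close> h0
    by (intro integral_cong) (simp add: powr_mult powr_powr)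
  also have "integral {a..x} (\<lambda>s. z s powr (\<beta> / \<alpha>) * h s) powr (1 / (r / \<alpha>)) \<le>
      (z x powr (\<beta> / \<alpha> + 1) / (\<beta> / \<alpha> + 1)) powr (1 / (r / \<alpha>))"
  proof (rule powr_mono2)
    show "integral {a..x} (\<lambda>s. z s powr (\<beta> / \<alpha>) * h s) \<le> z x powr (\<beta> / \<alpha> + 1) / (\<beta> / \<alpha> + 1)"
      unfolding z_def using \<open>a \<le> x\<close> \<open>\<alpha> > 0\<close> \<open>\<beta> > 0\<close> hc h0
      by (intro integral_antiderivative_powr_le) auto
  qed (use r \<open>\<alpha> > 0\<close> h0 in \<open>auto intro!: integral_nonneg_total\<close>)
  also have "\<dots> = (\<alpha> / (\<alpha> + \<beta>)) powr (\<alpha> / r) * z x powr ((\<alpha> + \<beta>) / r)"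
  proof -
    have "\<beta> / \<alpha> + 1 = (\<alpha> + \<beta>) / \<alpha>"
      using \<open>\<alpha> > 0\<close> by (simp add: field_simps)
    then have "z x powr (\<beta> / \<alpha> + 1) / (\<beta> / \<alpha> + 1) = \<alpha> / (\<alpha> + \<beta>) * z x powr ((\<alpha> + \<beta>) / \<alpha>)"
      by simp
    then show ?thesis
      using \<open>\<alpha> > 0\<close> by (simp only: powr_mult powr_powr) simp
  qed
  finally show ?thesis
    unfolding z_def h_def[abs_def] by (simp add: mult_left_mono mult.assoc mult.left_commute)
qed

subsection \<open>Widder derivatives\<close>

lemma is_jet_nth_deriv_on:
  assumes "C_on m S f"
  shows "is_jet S m (\<lambda>k. nth_deriv_on S k f)"
  using assms unfolding is_jet_def C_on_def
  by (auto simp: nth_deriv_on_def has_real_derivative_iff_has_vector_derivative differentiable_on_def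
      vector_derivative_works)

lemma widder_eq_jet:
  "widder S \<phi> i f x = jet_border (\<lambda>j k. nth_deriv_on S k (\<phi> j)) i (\<lambda>k. nth_deriv_on S k f) x /
    jet_wronskian (\<lambda>j k. nth_deriv_on S k (\<phi> j)) i x"
proof (cases i)
  case 0
  have "jet_border (\<lambda>j k. nth_deriv_on S k (\<phi> j)) 0 (\<lambda>k. nth_deriv_on S k f) x = f x"
    by (subst jet_border_zero) (auto simp: jet_wronskian_def nth_deriv_on_def)
  then show ?thesis using 0 by (simp add: widder_def jet_wronskian_def)
next
  case (Suc l)
  have "(\<lambda>(k, j). nth_deriv_on S k (if j < i then \<phi> j else f) x) =
      (\<lambda>(k, j). (if j < i then \<lambda>k. nth_deriv_on S k (\<phi> j) else (\<lambda>k. nth_deriv_on S k f)) k x)"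
    by (auto simp: fun_eq_iff)
  then show ?thesis
    using Suc by (simp add: widder_def wronskian_def Wr_def jet_wronskian_def)
qed

text \<open>Expansion along the last row: its cofactors do not see that row, so they are those of
  the Wronskian matrix at \<open>t\<close>.\<close>

lemma g_kernel_eq_jet:
  "g_kernel S \<phi> n x t = (\<Sum>j<Suc n. nth_deriv_on S 0 (\<phi> j) x *
    jet_kernel_coeff (\<lambda>j k. nth_deriv_on S k (\<phi> j)) (Suc n) j t)"
proof -
  let ?M = "Matrix.mat (Suc n) (Suc n) (\<lambda>(k, j). nth_deriv_on S k (\<phi> j) t)"
  let ?B = "Matrix.mat (Suc n) (Suc n)
    (\<lambda>(k, j). if k < n then nth_deriv_on S k (\<phi> j) t else \<phi> j x)"
  have "mat_delete ?B n j = mat_delete ?M n j" if "j < Suc n" for j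
    using that by (intro eq_matI) (auto simp: mat_delete_def)
  then have "Determinant.det ?B = (\<Sum>j<Suc n. \<phi> j x * cofactor ?M n j)"
    by (subst laplace_expansion_row[of _ "Suc n" n])
      (auto simp: cofactor_def simp del: sum.lessThan_Suc intro!: sum.cong)
  moreover have "g_kernel S \<phi> n x t = Determinant.det ?B / Determinant.det ?M"
  proof (cases "n = 0")
    case True
    then show ?thesis by (simp add: g_kernel_def det_def nth_deriv_on_def)
  next
    case False
    then show ?thesis by (simp add: g_kernel_def Wr_def wronskian_def)
  qed
  ultimately show ?thesis
    by (simp add: jet_kernel_coeff_def jet_cofactor_def jet_wronskian_def nth_deriv_on_def
        sum_divide_distrib del: sum.lessThan_Suc)
qed

theorem theorem3p3:
  fixes a b x \<alpha> \<beta> r :: real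
    and n :: nat
    and f u v :: "real \<Rightarrow> real"
    and \<phi> :: "nat \<Rightarrow> real \<Rightarrow> real"
  assumes "a < b"
    and "C_on (n + 1) {a..b} f"
    and "\<And>i. i \<le> n \<Longrightarrow> C_on (n + 1) {a..b} (\<phi> i)"
    and "\<And>i y. i \<le> n \<Longrightarrow> y \<in> {a..b} \<Longrightarrow> Wr {a..b} \<phi> i y > 0"
    and "\<And>i. i \<le> n \<Longrightarrow> widder {a..b} \<phi> i f a = 0"
    and "x \<in> {a..b}"
    and "\<alpha> > 0" and "\<beta> > 0" and "r > max 1 \<alpha>"
    and "continuous_on {a..b} u" and "continuous_on {a..b} v"
    and "\<And>s. s \<in> {a..b} \<Longrightarrow> u s \<ge> 0"
    and "\<And>s. s \<in> {a..b} \<Longrightarrow> v s > 0"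
  shows "\<bar>integral {a..x} (\<lambda>s. u s * \<bar>f s\<bar> powr \<beta> *
             \<bar>widder {a..b} \<phi> (n + 1) f s\<bar> powr \<alpha>)\<bar>
         \<le> C1 a b n \<phi> u v \<alpha> \<beta> r x *
           \<bar>integral {a..x} (\<lambda>s. v s * \<bar>widder {a..b} \<phi> (n + 1) f s\<bar> powr r)\<bar>
             powr ((\<alpha> + \<beta>) / r)"
proof -
  define U where "U j k = nth_deriv_on {a..b} k (\<phi> j)" for j k
  define F where "F k = nth_deriv_on {a..b} k f" for k
  define y where "y = widder {a..b} \<phi> (n + 1) f"
  define K where "K = g_kernel {a..b} \<phi> n"
  have x: "a \<le> x" "x \<le> b" using assms(6) by auto
  have U: "is_jet {a..b} (Suc n) (U j)" if "j < Suc n" for j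
    using is_jet_nth_deriv_on[OF assms(3)[of j]] that by (simp add: U_def[abs_def])
  have F: "is_jet {a..b} (Suc n) F"
    using is_jet_nth_deriv_on[OF assms(2)] by (simp add: F_def[abs_def])
  \<comment> \<open>\<open>jet_wronskian U m\<close> has size \<open>m\<close>, so it is
    \<open>W\<^sub>m\<^sub>-\<^sub>1\<close> for \<open>m > 0\<close>, and the empty determinant 1
    for \<open>m = 0\<close>.\<close>
  have W: "jet_wronskian U m s > 0" if "m \<le> Suc n" "s \<in> {a..b}" for m s
    using assms(4)[of "m - 1" s] that
    by (cases m) (auto simp: jet_wronskian_def Wr_def wronskian_def U_def)
  have W0: "jet_wronskian U (Suc n) s \<noteq> 0" if "s \<in> {a..b}" for s
    using W[of "Suc n" s] that by simp
  have widder: "widder {a..b} \<phi> i f s = jet_border U i F s / jet_wronskian U i s" for i s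
    unfolding U_def[abs_def] F_def[abs_def] by (rule widder_eq_jet)
  have K_eq: "K s t = (\<Sum>j<Suc n. U j 0 s * jet_kernel_coeff U (Suc n) j t)" for s t
    by (simp add: K_def g_kernel_eq_jet U_def[abs_def])
  have contU: "continuous_on {a..b} (U j k)" if "j < Suc n" "k < Suc n" for j k
    using is_jet_continuous[OF U] that by simp
  have y: "continuous_on {a..b} y"
  proof -
    have "continuous_on {a..b} (jet_border U (Suc n) F)"
      using is_jet_continuous[OF U] is_jet_continuous[OF F]
      by (intro continuous_on_jet_wronskian) auto
    moreover have "continuous_on {a..b} (jet_wronskian U (Suc n))"
      using contU by (intro continuous_on_jet_wronskian) auto
    ultimately have "continuous_on {a..b} (\<lambda>s. jet_border U (Suc n) F s / jet_wronskian U (Suc n) s)"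
      using W0 by (intro continuous_on_divide) auto
    then show ?thesis by (simp add: y_def widder)
  qed
  have K: "continuous_on ({a..b} \<times> {a..b}) (\<lambda>(s, t). K s t)"
  proof -
    have "continuous_on ({a..b} \<times> {a..b}) (\<lambda>p. U j 0 (fst p) * jet_kernel_coeff U (Suc n) j (snd p))"
      if "j < Suc n" for j
      using contU that W0 
      by (intro continuous_on_mult continuous_on_compose2[OF contU]
          continuous_on_compose2[OF continuous_on_jet_kernel_coeff]
          continuous_on_fst continuous_on_snd continuous_on_id) auto
    then show ?thesis
      unfolding K_eq case_prod_unfold by (intro continuous_on_sum) auto
  qed
  have K0: "K s t \<ge> 0" if "a \<le> t" "t \<le> s" "s \<le> b" for s t
    unfolding K_eq using U W that by (intro jet_kernel_nonneg[of _ a b]) auto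
  have "jet_border U i F a = 0 \<and> jet_wronskian U i a \<noteq> 0" if "i < Suc n" for i
  proof -
    have "jet_wronskian U i a > 0" "widder {a..b} \<phi> i f a = 0"
      using W[of i a] assms(1) assms(5)[of i] that by auto
    then show ?thesis by (auto simp: widder)
  qed
  then have init: "F k a = 0" if "k < Suc n" for k
    using jet_initial_zero[of "Suc n" U F a k] that by blast
  \<comment> \<open>The Taylor formula gives \<open>f s\<close> exactly; since \<open>K\<close> is
    nonnegative for \<open>t \<le> s\<close>, the absolute value passes to \<open>y\<close>
    alone.\<close>
  have f: "\<bar>f s\<bar> \<le> integral {a..s} (\<lambda>t. K s t * \<bar>y t\<bar>)" if s: "s \<in> {a..x}" for s
  proof -
    have "((\<lambda>t. K s t * y t) has_integral F 0 s) {a..s}"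
      unfolding K_eq y_def widder Suc_eq_plus1[symmetric]
      using widder_taylor[OF assms(1) U F W0 init, of s] s x by simp
    then have "integral {a..s} (\<lambda>t. K s t * y t) = f s" "(\<lambda>t. K s t * y t) integrable_on {a..s}"
      by (auto simp: F_def nth_deriv_on_def integral_unique)
    moreover have "(\<lambda>t. K s t * \<bar>y t\<bar>) integrable_on {a..s}"
      using continuous_on_slice[OF K, of s] y s x
      by (intro integrable_continuous_real continuous_on_mult continuous_on_rabs)
        (auto intro: continuous_on_subset)
    ultimately show ?thesis
      using K0 s x integral_norm_bound_integral[of "\<lambda>t. K s t * y t" "{a..s}" "\<lambda>t. K s t * \<bar>y t\<bar>"]
      by (simp add: abs_mult)
  qed
  have sub: "continuous_on {a..x} g" if "continuous_on {a..b} g" for g :: "real \<Rightarrow> real"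
    using that x by (auto intro: continuous_on_subset)
  have cf: "continuous_on {a..b} f"
    using is_jet_continuous[OF F, of 0] by (simp add: F_def nth_deriv_on_def)
  have P1: "P1 a b n \<phi> v r s =
      integral {a..s} (\<lambda>t. v t powr (- (1 / (r - 1))) * K s t powr (r / (r - 1)))" for s
    unfolding P1_def K_def
    by (intro abs_of_nonneg integral_nonneg_total) simp
  have "integral {a..x} (\<lambda>s. u s * \<bar>f s\<bar> powr \<beta> * \<bar>y s\<bar> powr \<alpha>) \<le>
      C1 a b n \<phi> u v \<alpha> \<beta> r x * integral {a..x} (\<lambda>s. v s * \<bar>y s\<bar> powr r) powr ((\<alpha> + \<beta>) / r)"
    unfolding C1_def P1
  proof (rule opial_kernel[where f="\<lambda>s. \<bar>f s\<bar>" and y="\<lambda>s. \<bar>y s\<bar>" and K=K])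
    show "continuous_on ({a..x} \<times> {a..x}) (\<lambda>(s, t). K s t)"
      by (rule continuous_on_subset[OF K]) (use x in auto)
  qed (use assms(7-) x f K0 in \<open>auto intro!: sub y cf continuous_on_rabs\<close>)
  moreover have "integral {a..x} (\<lambda>s. u s * \<bar>f s\<bar> powr \<beta> * \<bar>y s\<bar> powr \<alpha>) \<ge> 0"
    "integral {a..x} (\<lambda>s. v s * \<bar>y s\<bar> powr r) \<ge> 0"
    using assms(12,13) x by (auto intro!: integral_nonneg_total simp: less_imp_le)
  ultimately show ?thesis by (simp add: y_def)
qed

end
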